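(* For all $(i,j,t,\overrightarrow{t})\in\overrightarrow{\mathcal{E}}$, the overlapping time $\sigma_{ij}^{t\overrightarrow{t}}$ between the accelerating phase of $t$ on platform $i$ and the braking phase of $\overrightarrow{t}$ on platform $j$, where $(i,j)\in\Omega$, can be modelled by the following robust formulation: $$a_j^{\overrightarrow{t}} - d_i^t + \epsilon \leq \underline{\alpha}_i^t + \underline{\beta}_j^{\overrightarrow{t}} + M(1 - \lambda_{ij}^{t\overrightarrow{t}}),$$ $$d_i^t - a_j^{\overrightarrow{t}} + \epsilon \leq M(1 - \lambda_{ij}^{t\overrightarrow{t}}),$$ $$\sigma_{ij}^{t\overrightarrow{t}} \geq 0,$$ $$\sigma_{ij}^{t\overrightarrow{t}} \leq \underline{\alpha}_i^t \lambda_{ij}^{t\overrightarrow{t}},$$ $$\sigma_{ij}^{t\overrightarrow{t}} \leq \underline{\beta}_j^{\overrightarrow{t}} \lambda_{ij}^{t\overrightarrow{t}},$$ $$\sigma_{ij}^{t\overrightarrow{t}} \leq d_i^t - a_j^{\overrightarrow{t}} + \underline{\alpha}_i^t + \underline{\beta}_j^{\overrightarrow{t}} + M(1 - \lambda_{ij}^{t\overrightarrow{t}}),$$ $$\sigma_{ij}^{t\overrightarrow{t}} \leq a_j^{\overrightarrow{t}} - d_i^t + M(1 - \lambda_{ij}^{t\overrightarrow{t}}),$$ where $M$ is a large positive number, $\epsilon$ is a small positive number smaller than the time granularity considered, and $\lambda_{ij}^{t\overrightarrow{t}}$ is a binary variable which is one if and only if $\sigma_{ij}^{t\overrightarrow{t}}$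 is positive.
   Context: Railway setting. $\mathcal{N}$ is the finite set of platforms and $\mathcal{T}$ the finite set of trains of a railway network. For a train $t$, $\mathcal{N}^t\subseteq\mathcal{N}$ is the set of platforms it visits, and $\mathcal{T}_i\subseteq\mathcal{T}$ is the set of all trains which arrive at, dwell at and then depart from platform $i$. $\Omega$ is the set of platform pairs that are opposite to each other and powered by the same electrical substation. The decision variables $a_i^t$ and $d_i^t$ are the arrival time of train $t$ at platform $i$ and its departure time from platform $i$. An initial feasible timetable is given, with arrival times $\bar a_i^t$ and departure times $\bar d_i^t$. Temporally closest trains. Let $r$ be an empirical parameter chosen by the timetable designer, much smaller than the time horizon of the entire timetable. For $(i,j)\in\Omega$ and $t\in\mathcal{T}_i$, write $m_i^t=\frac{\bar a_i^t+\bar d_i^t}{2}$ (and likewise $m_j^x$ for $x\in\mathcal{T}_j$). The temporally closest train to the right of $t$, denoted $\overrightarrow{t}\in\mathcal{T}_j$, is the minimizer of $|m_i^t-m_j^{t'}|$ over $t'\in\{x\in\mathcal{T}_j: 0\le m_j^x-m_i^t\le r\}$. The temporally closest train to the left of $t$, denoted $\overleftarrow{t}\in\mathcal{T}_j$, is the minimizer of $|m_i^t-m_j^{t'}|$ over $t'\in\{x\in\mathcal{T}_j: 0< m_i^t-m_j^x\le r\}$. The temporally closest train $\tilde t$ to $t$ is the minimizer of $|m_i^t-m_j^{t'}|$ over $t'\in\{\overrightarrow{t},\overleftarrow{t}\}$, one of them being picked arbitrarily if both are equidistant from $t$. $\mathcal{E}$ is the set of all tuples $(i,j,t,\tilde t)$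 so obtained; it is partitioned into $\overrightarrow{\mathcal{E}}$ (tuples of the form $(i,j,t,\overrightarrow{t})$) and $\overleftarrow{\mathcal{E}}$ (tuples of the form $(i,j,t,\overleftarrow{t})$). Braking and accelerating phases. $a_i^{t-}$ is the start of the braking phase of train $t$ before arriving at platform $i$ (the phase ends at $a_i^t$), and $d_i^{t+}$ is the end of its accelerating phase after departing from platform $i$ (the phase starts at $d_i^t$). The durations are $\beta_i^t=a_i^t-a_i^{t-}$ and $\alpha_i^t=d_i^{t+}-d_i^t$. They depend on the trip time, which is not known in advance, but lie within known bounds $\alpha_i^t\in[\underline{\alpha}_i^t,\overline{\alpha}_i^t]$ and $\beta_i^t\in[\underline{\beta}_i^t,\overline{\beta}_i^t]$, so that $a_i^{t-}\in[a_i^t-\overline{\beta}_i^t,a_i^t-\underline{\beta}_i^t]$ and $d_i^{t+}\in[d_i^t+\underline{\alpha}_i^t,d_i^t+\overline{\alpha}_i^t]$. The formulation is called robust because it is meant to account for all $a_j^{\overrightarrow{t}-}$ and $d_i^{t+}$ in these intervals. Overlapping time. For given phases, the overlapping time of the accelerating phase of $t$ on platform $i$ and the braking phase of $\overrightarrow{t}$ on platform $j$ is $0$ if $a_j^{\overrightarrow{t}-}\ge d_i^{t+}$ or $a_j^{\overrightarrow{t}}\le d_i^t$, and is $\min\{d_i^{t+},a_j^{\overrightarrow{t}}\}-\max\{d_i^t,a_j^{\overrightarrow{t}-}\}$ otherwise. It is modelled by the hypograph approach, i.e. by upper bounds on the variable $\sigma_{ij}^{t\overrightarrow{t}}$, within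 an optimization problem whose objective is to maximize the sum of the overlapping times over all elements of $\overrightarrow{\mathcal{E}}$ and $\overleftarrow{\mathcal{E}}$. *)

theory Defs
  imports Complex_Main "HOL-Library.FuncSet"
begin

record ('n, 't) timetable =
  arr :: "'n \<Rightarrow> 't \<Rightarrow> real"
  dep :: "'n \<Rightarrow> 't \<Rightarrow> real"

text \<open>
  The field \<open>calling i\<close> is the set of trains that arrive at, dwell at and then depart from
  platform \<open>i\<close>. The field \<open>timetables\<close> is the set of timetables that satisfy all
  constraints of the optimization problem on arrival and departure times alone. The bounds
  \<open>acc_lb, acc_ub, brk_lb, brk_ub\<close> are those on the durations of the accelerating and
  braking phases.
\<close>

record ('n, 't, 's) railway =
  platforms :: "'n set"
  trains :: "'t set"
  visited :: "'t \<Rightarrow> 'n set"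
  calling :: "'n \<Rightarrow> 't set"
  opposite :: "'n \<Rightarrow> 'n \<Rightarrow> bool"
  substation :: "'n \<Rightarrow> 's"
  timetables :: "('n, 't) timetable set"
  initial :: "('n, 't) timetable"
  horizon :: real
  granularity :: real
  radius :: real
  acc_lb :: "'n \<Rightarrow> 't \<Rightarrow> real"
  acc_ub :: "'n \<Rightarrow> 't \<Rightarrow> real"
  brk_lb :: "'n \<Rightarrow> 't \<Rightarrow> real"
  brk_ub :: "'n \<Rightarrow> 't \<Rightarrow> real"

definition on_grid :: "real \<Rightarrow> real \<Rightarrow> bool" where
  "on_grid g x \<longleftrightarrow> (\<exists>k :: int. x = of_int k * g)"

text \<open>
  The time horizon bounds all event times; without such a bound no constant \<open>M\<close> is large
  enough for every timetable. Event times and the lower bounds on the durations are multiples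
  of the time granularity, which is what allows a strict inequality between them to be written
  as a weak one with a slack smaller than the granularity.
\<close>

definition wf_railway :: "('n, 't, 's) railway \<Rightarrow> bool" where
  "wf_railway R \<longleftrightarrow>
     finite (platforms R) \<and> finite (trains R) \<and>
     (\<forall>t \<in> trains R. visited R t \<subseteq> platforms R) \<and>
     (\<forall>i \<in> platforms R. calling R i \<subseteq> {t \<in> trains R. i \<in> visited R t}) \<and>
     0 < granularity R \<and> 0 < radius R \<and> radius R < horizon R \<and>
     initial R \<in> timetables R \<and>
     (\<forall>tt \<in> timetables R. \<forall>i \<in> platforms R. \<forall>t \<in> calling R i.
        arr tt i t \<in> {0..horizon R} \<and> on_grid (granularity R) (arr tt i t) \<and>
        dep tt i t \<in> {0..horizon R} \<and> on_grid (granularity R) (dep tt i t)) \<and>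
     (\<forall>i \<in> platforms R. \<forall>t \<in> calling R i.
        0 < acc_lb R i t \<and> acc_lb R i t \<le> acc_ub R i t \<and>
        on_grid (granularity R) (acc_lb R i t) \<and>
        0 < brk_lb R i t \<and> brk_lb R i t \<le> brk_ub R i t \<and>
        on_grid (granularity R) (brk_lb R i t))"

definition platform_pairs :: "('n, 't, 's) railway \<Rightarrow> ('n \<times> 'n) set" where
  "platform_pairs R =
     {(i, j). i \<in> platforms R \<and> j \<in> platforms R \<and> opposite R i j \<and> substation R i = substation R j}"


subsection \<open>Temporally closest trains\<close>

definition mid :: "('n, 't, 's) railway \<Rightarrow> 'n \<Rightarrow> 't \<Rightarrow> real" where
  "mid R i t = (arr (initial R) i t + dep (initial R) i t) / 2"

definition closest_right :: "('n, 't, 's) railway \<Rightarrow> 'n \<Rightarrow> 'n \<Rightarrow> 't \<Rightarrow> 't \<Rightarrow> bool" where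
  "closest_right R i j t =
     is_arg_min (\<lambda>x. \<bar>mid R i t - mid R j x\<bar>)
       (\<lambda>x. x \<in> calling R j \<and> 0 \<le> mid R j x - mid R i t \<and> mid R j x - mid R i t \<le> radius R)"

definition closest_left :: "('n, 't, 's) railway \<Rightarrow> 'n \<Rightarrow> 'n \<Rightarrow> 't \<Rightarrow> 't \<Rightarrow> bool" where
  "closest_left R i j t =
     is_arg_min (\<lambda>x. \<bar>mid R i t - mid R j x\<bar>)
       (\<lambda>x. x \<in> calling R j \<and> 0 < mid R i t - mid R j x \<and> mid R i t - mid R j x \<le> radius R)"

definition closest :: "('n, 't, 's) railway \<Rightarrow> 'n \<Rightarrow> 'n \<Rightarrow> 't \<Rightarrow> 't \<Rightarrow> bool" where
  "closest R i j t =
     is_arg_min (\<lambda>x. \<bar>mid R i t - mid R j x\<bar>)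
       (\<lambda>x. closest_right R i j t x \<or> closest_left R i j t x)"

text \<open>
  Minimizers need not be unique, and there is none if no train is within the radius. A selection
  picks one closest train wherever there is one, breaking ties arbitrarily.
\<close>

definition closest_selection ::
  "('n, 't, 's) railway \<Rightarrow> ('n \<Rightarrow> 'n \<Rightarrow> 't \<Rightarrow> 't option) \<Rightarrow> bool" where
  "closest_selection R sel \<longleftrightarrow>
     (\<forall>(i, j) \<in> platform_pairs R. \<forall>t \<in> calling R i.
        case sel i j t of
          None \<Rightarrow> \<not> (\<exists>x. closest R i j t x)
        | Some x \<Rightarrow> closest R i j t x)"

definition train_pairs ::
  "('n, 't, 's) railway \<Rightarrow> ('n \<Rightarrow> 'n \<Rightarrow> 't \<Rightarrow> 't option) \<Rightarrow> ('n \<times> 'n \<times> 't \<times> 't) set" where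
  "train_pairs R sel =
     {(i, j, t, x). (i, j) \<in> platform_pairs R \<and> t \<in> calling R i \<and> sel i j t = Some x}"

definition right_pairs ::
  "('n, 't, 's) railway \<Rightarrow> ('n \<Rightarrow> 'n \<Rightarrow> 't \<Rightarrow> 't option) \<Rightarrow> ('n \<times> 'n \<times> 't \<times> 't) set" where
  "right_pairs R sel = {(i, j, t, x) \<in> train_pairs R sel. closest_right R i j t x}"

definition left_pairs ::
  "('n, 't, 's) railway \<Rightarrow> ('n \<Rightarrow> 'n \<Rightarrow> 't \<Rightarrow> 't option) \<Rightarrow> ('n \<times> 'n \<times> 't \<times> 't) set" where
  "left_pairs R sel = {(i, j, t, x) \<in> train_pairs R sel. closest_left R i j t x}"


subsection \<open>Overlapping time of an accelerating and a braking phase\<close>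

text \<open>The accelerating phase is \<open>[d, dp]\<close> and the braking phase is \<open>[am, a]\<close>.\<close>

definition overlap :: "real \<Rightarrow> real \<Rightarrow> real \<Rightarrow> real \<Rightarrow> real" where
  "overlap d dp am a = (if am \<ge> dp \<or> a \<le> d then 0 else min dp a - max d am)"

definition acc_ends :: "('n, 't, 's) railway \<Rightarrow> ('n, 't) timetable \<Rightarrow> 'n \<Rightarrow> 't \<Rightarrow> real set" where
  "acc_ends R tt i t = {dep tt i t + acc_lb R i t .. dep tt i t + acc_ub R i t}"

definition brk_starts :: "('n, 't, 's) railway \<Rightarrow> ('n, 't) timetable \<Rightarrow> 'n \<Rightarrow> 't \<Rightarrow> real set" where
  "brk_starts R tt j x = {arr tt j x - brk_ub R j x .. arr tt j x - brk_lb R j x}"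

definition robust_hypograph ::
  "('n, 't, 's) railway \<Rightarrow> ('n, 't) timetable \<Rightarrow> 'n \<times> 'n \<times> 't \<times> 't \<Rightarrow> real set" where
  "robust_hypograph R tt = (\<lambda>(i, j, t, x).
     {s. 0 \<le> s \<and> (\<forall>dp \<in> acc_ends R tt i t. \<forall>am \<in> brk_starts R tt j x.
                     s \<le> overlap (dep tt i t) dp am (arr tt j x))})"

definition robust_overlap ::
  "('n, 't, 's) railway \<Rightarrow> ('n, 't) timetable \<Rightarrow> 'n \<times> 'n \<times> 't \<times> 't \<Rightarrow> real" where
  "robust_overlap R tt = (\<lambda>(i, j, t, x).
     INF (dp, am) \<in> acc_ends R tt i t \<times> brk_starts R tt j x.
       overlap (dep tt i t) dp am (arr tt j x))"


subsection \<open>The mixed-integer formulation\<close>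

definition formulation ::
  "('n, 't, 's) railway \<Rightarrow> real \<Rightarrow> real \<Rightarrow> ('n, 't) timetable \<Rightarrow> 'n \<times> 'n \<times> 't \<times> 't \<Rightarrow>
   real \<Rightarrow> real \<Rightarrow> bool" where
  "formulation R M \<epsilon> tt = (\<lambda>(i, j, t, x) \<sigma> l.
     let d = dep tt i t; a = arr tt j x; \<alpha> = acc_lb R i t; \<beta> = brk_lb R j x in
       l \<in> {0, 1} \<and>
       a - d + \<epsilon> \<le> \<alpha> + \<beta> + M * (1 - l) \<and>
       d - a + \<epsilon> \<le> M * (1 - l) \<and>
       \<sigma> \<ge> 0 \<and>
       \<sigma> \<le> \<alpha> * l \<and>
       \<sigma> \<le> \<beta> * l \<and>
       \<sigma> \<le> d - a + \<alpha> + \<beta> + M * (1 - l) \<and>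
       \<sigma> \<le> a - d + M * (1 - l))"

text \<open>
  In the two optimization problems below, \<open>L\<close> stands for the constraints on the overlapping
  times of the left pairs (an arbitrary condition, with any auxiliary variables projected out).
  In the first, \<open>\<sigma>\<close> on the right pairs is the worst-case overlapping time itself; in the
  second, it is a variable constrained by the formulation.
\<close>

definition robust_optimal ::
  "('n, 't, 's) railway \<Rightarrow> ('n \<Rightarrow> 'n \<Rightarrow> 't \<Rightarrow> 't option) \<Rightarrow>
   (('n, 't) timetable \<Rightarrow> ('n \<times> 'n \<times> 't \<times> 't \<Rightarrow> real) \<Rightarrow> bool) \<Rightarrow>
   ('n, 't) timetable \<Rightarrow> ('n \<times> 'n \<times> 't \<times> 't \<Rightarrow> real) \<Rightarrow> bool" where
  "robust_optimal R sel L tt \<sigma> \<longleftrightarrow>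
     is_arg_max (\<lambda>(tt, \<sigma>). \<Sum>e \<in> right_pairs R sel \<union> left_pairs R sel. \<sigma> e)
       (\<lambda>(tt, \<sigma>). tt \<in> timetables R \<and> L tt (restrict \<sigma> (left_pairs R sel)) \<and>
          (\<forall>e \<in> right_pairs R sel. \<sigma> e = robust_overlap R tt e))
       (tt, \<sigma>)"

definition formulation_optimal ::
  "('n, 't, 's) railway \<Rightarrow> ('n \<Rightarrow> 'n \<Rightarrow> 't \<Rightarrow> 't option) \<Rightarrow>
   (('n, 't) timetable \<Rightarrow> ('n \<times> 'n \<times> 't \<times> 't \<Rightarrow> real) \<Rightarrow> bool) \<Rightarrow> real \<Rightarrow> real \<Rightarrow>
   ('n, 't) timetable \<Rightarrow> ('n \<times> 'n \<times> 't \<times> 't \<Rightarrow> real) \<Rightarrow> ('n \<times> 'n \<times> 't \<times> 't \<Rightarrow> real) \<Rightarrow> bool"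
  where
  "formulation_optimal R sel L M \<epsilon> tt \<sigma> l \<longleftrightarrow>
     is_arg_max (\<lambda>(tt, \<sigma>, l). \<Sum>e \<in> right_pairs R sel \<union> left_pairs R sel. \<sigma> e)
       (\<lambda>(tt, \<sigma>, l). tt \<in> timetables R \<and> L tt (restrict \<sigma> (left_pairs R sel)) \<and>
          (\<forall>e \<in> right_pairs R sel. formulation R M \<epsilon> tt e (\<sigma> e) (l e)))
       (tt, \<sigma>, l)"

end

theory Submission imports Defs begin

text \<open>
  An overlapping time can only grow when the accelerating phase ends later or the braking phase
  starts earlier. The worst case over all phases is therefore attained when both have their least
  durations \<open>\<alpha>\<close> and \<open>\<beta>\<close>, where it is the positive part of
  \<open>min {\<alpha>, \<beta>, a - d, d - a + \<alpha> + \<beta>}\<close>. These four terms are the upper bounds on \<open>\<sigma>\<close>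
  in the formulation with \<open>\<lambda> = 1\<close>.

  The two inequalities with \<open>\<epsilon>\<close> say, for \<open>\<lambda> = 1\<close>, that \<open>d < a < d + \<alpha> + \<beta>\<close>, which holds
  exactly if the worst case is positive: all quantities are multiples of the granularity, so that a
  strict inequality between them leaves room for \<open>\<epsilon>\<close>. For \<open>\<lambda> = 0\<close> the formulation forces
  \<open>\<sigma> = 0\<close>, and \<open>M\<close> makes the other constraints void once it exceeds every difference of
  event times by \<open>\<epsilon>\<close>. Hence \<open>\<sigma>\<close> ranges over the interval from \<open>0\<close> to the worst case
  (\<open>formulation_iff\<close>, \<open>robust_hypograph_eq\<close>).

  As to the optimization problems, the right pairs are disjoint from the left ones, so the
  overlapping times of the right pairs enter no constraint but the formulation, each in its own
  copy. Raising them to their upper ends keeps a solution feasible and increases the objective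
  unless they are there already; in an optimum \<open>\<sigma>\<close> is thus the worst case itself, and \<open>\<lambda>\<close>
  is determined by its sign.
\<close>

section \<open>The worst-case overlapping time\<close>

text \<open>
  Phases of nonnegative duration share at most one point exactly if the length formula is at most \<open>0\<close>. The
  case distinction can thus be absorbed into a maximum, which makes the monotonicity visible.
\<close>

lemma overlap_eq_positive_part:
  assumes "d \<le> dp" and "am \<le> a"
  shows "overlap d dp am a = max 0 (min dp a - max d am)"
  using assms unfolding overlap_def by auto

lemma overlap_mono:
  assumes "d \<le> dp" and "dp \<le> dp'" and "am' \<le> am" and "am \<le> a"
  shows "overlap d dp am a \<le> overlap d dp' am' a"
  using assms by (simp add: overlap_eq_positive_part)

lemma overlap_durations:
  fixes d a \<alpha> \<beta> :: real
  assumes "0 \<le> \<alpha>" and "0 \<le> \<beta>"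
  shows "overlap d (d + \<alpha>) (a - \<beta>) a = max 0 (min (min \<alpha> \<beta>) (min (a - d) (d - a + \<alpha> + \<beta>)))"
  using assms by (simp add: overlap_eq_positive_part min_def max_def)

context
  fixes R :: "('n, 't, 's) railway" and sel :: "'n \<Rightarrow> 'n \<Rightarrow> 't \<Rightarrow> 't option"
  assumes wf: "wf_railway R"
begin

lemma right_pair_calling:
  assumes "(i, j, t, x) \<in> right_pairs R sel"
  shows "i \<in> platforms R" and "j \<in> platforms R" and "t \<in> calling R i" and "x \<in> calling R j"
  using assms
  by (auto simp: right_pairs_def train_pairs_def platform_pairs_def closest_right_def is_arg_min_def)

lemma phase_bounds:
  assumes "i \<in> platforms R" and "t \<in> calling R i"
  shows "0 < acc_lb R i t" and "acc_lb R i t \<le> acc_ub R i t"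
    and "0 < brk_lb R i t" and "brk_lb R i t \<le> brk_ub R i t"
  using wf assms unfolding wf_railway_def by blast+

lemma least_durations_minimize_overlap:
  assumes e: "(i, j, t, x) \<in> right_pairs R sel"
    and "dp \<in> acc_ends R tt i t" and "am \<in> brk_starts R tt j x"
  shows "overlap (dep tt i t) (dep tt i t + acc_lb R i t) (arr tt j x - brk_lb R j x) (arr tt j x)
    \<le> overlap (dep tt i t) dp am (arr tt j x)"
  using assms phase_bounds[OF right_pair_calling(1,3)[OF e]] phase_bounds[OF right_pair_calling(2,4)[OF e]]
  by (intro overlap_mono) (auto simp: acc_ends_def brk_starts_def)

lemma least_durations_possible:
  assumes e: "(i, j, t, x) \<in> right_pairs R sel"
  shows "dep tt i t + acc_lb R i t \<in> acc_ends R tt i t"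
    and "arr tt j x - brk_lb R j x \<in> brk_starts R tt j x"
  using phase_bounds[OF right_pair_calling(1,3)[OF e]] phase_bounds[OF right_pair_calling(2,4)[OF e]]
  by (auto simp: acc_ends_def brk_starts_def)

lemma robust_overlap_eq_least_durations:
  assumes e: "(i, j, t, x) \<in> right_pairs R sel"
  shows "robust_overlap R tt (i, j, t, x) =
    overlap (dep tt i t) (dep tt i t + acc_lb R i t) (arr tt j x - brk_lb R j x) (arr tt j x)"
  unfolding robust_overlap_def prod.case
proof (rule cInf_eq_minimum)
  show "overlap (dep tt i t) (dep tt i t + acc_lb R i t) (arr tt j x - brk_lb R j x) (arr tt j x)
    \<in> (\<lambda>(dp, am). overlap (dep tt i t) dp am (arr tt j x)) ` (acc_ends R tt i t \<times> brk_starts R tt j x)"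
    using least_durations_possible[OF e] by (force intro!: image_eqI)
next
  fix y
  assume "y \<in> (\<lambda>(dp, am). overlap (dep tt i t) dp am (arr tt j x)) `
    (acc_ends R tt i t \<times> brk_starts R tt j x)"
  then show "overlap (dep tt i t) (dep tt i t + acc_lb R i t) (arr tt j x - brk_lb R j x) (arr tt j x) \<le> y"
    using least_durations_minimize_overlap[OF e] by auto
qed

lemma robust_overlap_eq:
  fixes tt :: "('n, 't) timetable"
  assumes e: "(i, j, t, x) \<in> right_pairs R sel"
  defines "d \<equiv> dep tt i t" and "a \<equiv> arr tt j x" and "\<alpha> \<equiv> acc_lb R i t" and "\<beta> \<equiv> brk_lb R j x"
  shows "robust_overlap R tt (i, j, t, x) =
    max 0 (min (min \<alpha> \<beta>) (min (a - d) (d - a + \<alpha> + \<beta>)))"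
  using phase_bounds[OF right_pair_calling(1,3)[OF e]] phase_bounds[OF right_pair_calling(2,4)[OF e]]
  unfolding robust_overlap_eq_least_durations[OF e] assms(2-)
  by (intro overlap_durations) auto

lemma robust_overlap_nonneg:
  assumes "e \<in> right_pairs R sel"
  shows "0 \<le> robust_overlap R tt e"
  using assms by (cases e) (simp add: robust_overlap_eq)

lemma robust_hypograph_eq:
  assumes "e \<in> right_pairs R sel"
  shows "robust_hypograph R tt e = {0..robust_overlap R tt e}"
proof -
  obtain i j t x where e_eq: "e = (i, j, t, x)"
    by (cases e)
  have e: "(i, j, t, x) \<in> right_pairs R sel"
    using assms e_eq by simp
  have "(\<forall>dp \<in> acc_ends R tt i t. \<forall>am \<in> brk_starts R tt j x. s \<le> overlap (dep tt i t) dp am (arr tt j x))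
      \<longleftrightarrow> s \<le> robust_overlap R tt (i, j, t, x)" for s
    unfolding robust_overlap_eq_least_durations[OF e]
    using least_durations_possible[OF e]
    by (blast intro: order_trans[OF _ least_durations_minimize_overlap[OF e]])
  then show ?thesis
    by (auto simp only: e_eq robust_hypograph_def prod.case atLeastAtMost_iff mem_Collect_eq)
qed


section \<open>The solutions of the formulation\<close>

lemma on_grid_add: "on_grid g x \<Longrightarrow> on_grid g y \<Longrightarrow> on_grid g (x + y)"
  unfolding on_grid_def by (metis distrib_right of_int_add)

lemma on_grid_less_imp_add_le:
  assumes "0 < g" and "on_grid g x" and "on_grid g y" and "x < y"
  shows "x + g \<le> y"
proof -
  obtain k l :: int where x: "x = of_int k * g" and y: "y = of_int l * g"
    using assms unfolding on_grid_def by blast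
  with assms have "k + 1 \<le> l"
    by (simp add: mult_less_cancel_right)
  then have "(of_int k + 1) * g \<le> of_int l * g"
    using \<open>0 < g\<close> by (intro mult_right_mono) linarith+
  then show ?thesis
    by (simp add: x y algebra_simps)
qed

text \<open>
  The binary variable being one is possible only when the worst case is positive; the sign of
  \<open>\<sigma>\<close> itself need not agree, since \<open>\<lambda> = 1\<close> admits \<open>\<sigma> = 0\<close>.
\<close>

lemma formulation_iff:
  assumes tt: "tt \<in> timetables R" and e: "e \<in> right_pairs R sel"
    and \<epsilon>: "0 < \<epsilon>" "\<epsilon> < granularity R" and M: "horizon R + granularity R \<le> M"
  shows "formulation R M \<epsilon> tt e \<sigma> l \<longleftrightarrow>
    l = 0 \<and> \<sigma> = 0 \<or> l = 1 \<and> 0 < robust_overlap R tt e \<and> \<sigma> \<in> {0..robust_overlap R tt e}"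
proof -
  obtain i j t x where e_eq: "e = (i, j, t, x)"
    by (cases e)
  have e': "(i, j, t, x) \<in> right_pairs R sel"
    using e e_eq by simp
  note callings = right_pair_calling[OF e']
  define d a \<alpha> \<beta> where "d = dep tt i t" and "a = arr tt j x"
    and "\<alpha> = acc_lb R i t" and "\<beta> = brk_lb R j x"
  note defs = this
  have pos: "0 < \<alpha>" "0 < \<beta>"
    using phase_bounds callings by (auto simp: defs)
  have range: "d \<in> {0..horizon R}" "a \<in> {0..horizon R}"
    using wf tt callings unfolding wf_railway_def defs by blast+
  have grid: "on_grid (granularity R) d" "on_grid (granularity R) a"
    "on_grid (granularity R) \<alpha>" "on_grid (granularity R) \<beta>"
    using wf tt callings unfolding wf_railway_def defs by blast+
  have g: "0 < granularity R"
    using \<epsilon> by linarith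
  have W: "robust_overlap R tt e = max 0 (min (min \<alpha> \<beta>) (min (a - d) (d - a + \<alpha> + \<beta>)))"
    unfolding e_eq defs by (rule robust_overlap_eq[OF e'])
  have start: "d - a + \<epsilon> \<le> 0 \<longleftrightarrow> d < a"
    using on_grid_less_imp_add_le[OF g grid(1,2)] \<epsilon> by auto
  have finish: "a - d + \<epsilon> \<le> \<alpha> + \<beta> \<longleftrightarrow> a < d + \<alpha> + \<beta>"
    using on_grid_less_imp_add_le[OF g grid(2) on_grid_add[OF on_grid_add[OF grid(1,3)] grid(4)]] \<epsilon>
    by auto
  have W_pos: "0 < robust_overlap R tt e \<longleftrightarrow> d < a \<and> a < d + \<alpha> + \<beta>"
    unfolding W using pos by auto
  have F: "formulation R M \<epsilon> tt e \<sigma> l \<longleftrightarrow>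
      l \<in> {0, 1} \<and> a - d + \<epsilon> \<le> \<alpha> + \<beta> + M * (1 - l) \<and> d - a + \<epsilon> \<le> M * (1 - l) \<and>
      \<sigma> \<ge> 0 \<and> \<sigma> \<le> \<alpha> * l \<and> \<sigma> \<le> \<beta> * l \<and>
      \<sigma> \<le> d - a + \<alpha> + \<beta> + M * (1 - l) \<and> \<sigma> \<le> a - d + M * (1 - l)"
    by (simp add: formulation_def e_eq defs Let_def)
  consider "l = 0" | "l = 1" | "l \<notin> {0, 1}"
    by blast
  then show ?thesis
  proof cases
    case 1
    then show ?thesis
      using pos range M \<epsilon> unfolding F by auto
  next
    case 2
    have "formulation R M \<epsilon> tt e \<sigma> l \<longleftrightarrow> d < a \<and> a < d + \<alpha> + \<beta> \<and> 0 \<le> \<sigma> \<and>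
        \<sigma> \<le> \<alpha> \<and> \<sigma> \<le> \<beta> \<and> \<sigma> \<le> d - a + \<alpha> + \<beta> \<and> \<sigma> \<le> a - d"
      unfolding F start[symmetric] finish[symmetric] using 2 by auto
    also have "\<dots> \<longleftrightarrow> 0 < robust_overlap R tt e \<and> \<sigma> \<in> {0..robust_overlap R tt e}"
      unfolding W_pos unfolding W using pos by auto
    finally show ?thesis
      using 2 by simp
  next
    case 3
    then show ?thesis
      unfolding F by auto
  qed
qed


section \<open>Equivalence of the optimization problems\<close>

lemma finite_right_left_pairs: "finite (right_pairs R sel \<union> left_pairs R sel)"
proof (rule finite_subset)
  show "right_pairs R sel \<union> left_pairs R sel \<subseteq> platforms R \<times> platforms R \<times> trains R \<times> trains R"
  proof -
    have "t \<in> trains R" if "i \<in> platforms R" and "t \<in> calling R i" for i t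
      using wf that unfolding wf_railway_def by blast
    then show ?thesis
      by (auto simp: right_pairs_def left_pairs_def train_pairs_def platform_pairs_def
          closest_right_def closest_left_def is_arg_min_def)
  qed
  show "finite (platforms R \<times> platforms R \<times> trains R \<times> trains R)"
    using wf by (simp add: wf_railway_def)
qed

end

lemma right_left_pairs_disjoint: "right_pairs R sel \<inter> left_pairs R sel = {}"
  by (auto simp: right_pairs_def left_pairs_def closest_right_def closest_left_def is_arg_min_def)

text \<open>
  This is the principle of the hypograph approach: \<open>\<sigma>\<close> is bounded above by \<open>w\<close> on \<open>A\<close>, the
  other constraints see it on the disjoint set \<open>B\<close> only, and a feasible \<open>\<sigma>\<close> stays feasible, with
  suitable auxiliary variables, when it is raised to \<open>w\<close> on \<open>A\<close>. So maximizing \<open>\<sigma>\<close> is as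
  good as fixing it at \<open>w\<close>.
\<close>

lemma hypograph_optimum_iff:
  fixes w :: "'y \<Rightarrow> 'e \<Rightarrow> real" and F :: "'y \<Rightarrow> 'e \<Rightarrow> real \<Rightarrow> 'l \<Rightarrow> bool"
  assumes fin: "finite (A \<union> B)" and disj: "A \<inter> B = {}"
    and le: "\<And>y e s l. y \<in> Y \<Longrightarrow> e \<in> A \<Longrightarrow> F y e s l \<Longrightarrow> s \<le> w y e"
    and tight: "\<And>y e. y \<in> Y \<Longrightarrow> e \<in> A \<Longrightarrow> \<exists>l. F y e (w y e) l"
  shows "is_arg_max (\<lambda>(y, \<sigma>, l). \<Sum>e \<in> A \<union> B. \<sigma> e)
      (\<lambda>(y, \<sigma>, l). y \<in> Y \<and> L y (restrict \<sigma> B) \<and> (\<forall>e \<in> A. F y e (\<sigma> e) (l e))) (y, \<sigma>, l) \<longleftrightarrow>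
    is_arg_max (\<lambda>(y, \<sigma>). \<Sum>e \<in> A \<union> B. \<sigma> e)
      (\<lambda>(y, \<sigma>). y \<in> Y \<and> L y (restrict \<sigma> B) \<and> (\<forall>e \<in> A. \<sigma> e = w y e)) (y, \<sigma>) \<and>
    (\<forall>e \<in> A. F y e (w y e) (l e))" (is "?relaxed \<longleftrightarrow> ?exact \<and> ?aux")
proof -
  define raise where "raise y \<sigma> = (\<lambda>e. if e \<in> A then w y e else \<sigma> e)" for y and \<sigma> :: "'e \<Rightarrow> real"
  have raise_A: "raise y \<sigma> e = w y e" if "e \<in> A" for y \<sigma> e
    using that by (simp add: raise_def)
  have raise_B: "restrict (raise y \<sigma>) B = restrict \<sigma> B" for y \<sigma>
    using disj by (intro restrict_ext) (auto simp: raise_def)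
  have raise_ge: "\<sigma> e \<le> raise y \<sigma> e" if "y \<in> Y" and "\<forall>e \<in> A. F y e (\<sigma> e) (l e)" for y \<sigma> l e
    using that le by (auto simp: raise_def)
  show ?thesis
  proof
    assume opt: ?relaxed
    then have y: "y \<in> Y" and L: "L y (restrict \<sigma> B)" and F: "\<forall>e \<in> A. F y e (\<sigma> e) (l e)"
      by (auto simp: is_arg_max_def)
    have relaxed_best: "sum \<sigma>' (A \<union> B) \<le> sum \<sigma> (A \<union> B)"
      if "y' \<in> Y" and "L y' (restrict \<sigma>' B)" and "\<forall>e \<in> A. F y' e (\<sigma>' e) (l' e)" for y' \<sigma>' l'
      using opt[unfolded is_arg_max_linorder, THEN conjunct2, THEN spec, of "(y', \<sigma>', l')"] that
      by simp
    have best: "sum \<sigma>' (A \<union> B) \<le> sum \<sigma> (A \<union> B)"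
      if "y' \<in> Y" and "L y' (restrict \<sigma>' B)" and exact: "\<forall>e \<in> A. \<sigma>' e = w y' e" for y' \<sigma>'
    proof -
      have "\<forall>e \<in> A. \<exists>l. F y' e (\<sigma>' e) l"
        using tight[OF \<open>y' \<in> Y\<close>] exact by simp
      from bchoice[OF this] obtain l' where "\<forall>e \<in> A. F y' e (\<sigma>' e) (l' e)"
        by blast
      with that show ?thesis
        by (intro relaxed_best)
    qed
    \<comment> \<open>The raised solution competes with \<open>\<sigma>\<close> and dominates it termwise, so no term can differ.\<close>
    have "sum (raise y \<sigma>) (A \<union> B) \<le> sum \<sigma> (A \<union> B)"
      using y L by (intro best) (auto simp: raise_A raise_B)
    moreover have "sum \<sigma> (A \<union> B) \<le> sum (raise y \<sigma>) (A \<union> B)"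
      using raise_ge[OF y F] by (intro sum_mono) auto
    ultimately have "sum \<sigma> (A \<union> B) = sum (raise y \<sigma>) (A \<union> B)"
      by linarith
    from sum_mono_inv[OF this raise_ge[OF y F] _ fin] have "\<forall>e \<in> A. \<sigma> e = w y e"
      using raise_A[of _ y \<sigma>] by simp
    with y L F show "?exact \<and> ?aux"
      by (auto simp: is_arg_max_linorder intro: best)
  next
    assume "?exact \<and> ?aux"
    then have opt: ?exact and aux: ?aux
      by auto
    have best: "sum \<sigma>' (A \<union> B) \<le> sum \<sigma> (A \<union> B)"
      if y': "y' \<in> Y" and L': "L y' (restrict \<sigma>' B)" and F': "\<forall>e \<in> A. F y' e (\<sigma>' e) (l' e)"
      for y' \<sigma>' l'
    proof -
      have "sum \<sigma>' (A \<union> B) \<le> sum (raise y' \<sigma>') (A \<union> B)"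
        using raise_ge[OF y' F'] by (intro sum_mono) auto
      also have "\<dots> \<le> sum \<sigma> (A \<union> B)"
        using opt[unfolded is_arg_max_linorder, THEN conjunct2, THEN spec, of "(y', raise y' \<sigma>')"] y' L'
        by (simp add: raise_A raise_B)
      finally show ?thesis .
    qed
    have "y \<in> Y" and "L y (restrict \<sigma> B)" and "\<forall>e \<in> A. F y e (\<sigma> e) (l e)"
      using opt aux by (auto simp: is_arg_max_def)
    then show ?relaxed
      by (auto simp: is_arg_max_linorder intro: best)
  qed
qed

theorem lemma1:
  fixes R :: "('n, 't, 's) railway"
    and sel :: "'n \<Rightarrow> 'n \<Rightarrow> 't \<Rightarrow> 't option"
    and \<epsilon> :: real
  assumes "wf_railway R"
    and "closest_selection R sel"
    and "0 < \<epsilon>" and "\<epsilon> < granularity R"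
  shows "\<exists>M\<^sub>0 > 0. \<forall>M \<ge> M\<^sub>0.
    (\<forall>tt \<in> timetables R. \<forall>e \<in> right_pairs R sel.
       (\<forall>\<sigma> l. formulation R M \<epsilon> tt e \<sigma> l \<longrightarrow> \<sigma> \<in> robust_hypograph R tt e) \<and>
       (\<forall>\<sigma> \<in> robust_hypograph R tt e.
          \<exists>l. formulation R M \<epsilon> tt e \<sigma> l \<and> (l = 1 \<longleftrightarrow> \<sigma> > 0))) \<and>
    (\<forall>L tt \<sigma> l.
       formulation_optimal R sel L M \<epsilon> tt \<sigma> l \<longleftrightarrow>
         robust_optimal R sel L tt \<sigma> \<and>
         (\<forall>e \<in> right_pairs R sel. l e \<in> {0, 1} \<and> (l e = 1 \<longleftrightarrow> \<sigma> e > 0)))"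
  \<comment> \<open>Event times differ by at most the horizon, and \<open>\<epsilon>\<close> is below the granularity.\<close>
proof (rule exI[of _ "horizon R + granularity R"], intro conjI allI impI ballI)
  show "0 < horizon R + granularity R"
    using assms(1) by (auto simp: wf_railway_def)
next
  fix M tt e \<sigma> l
  assume M: "horizon R + granularity R \<le> M" and tt: "tt \<in> timetables R"
    and e: "e \<in> right_pairs R sel" and "formulation R M \<epsilon> tt e \<sigma> l"
  then show "\<sigma> \<in> robust_hypograph R tt e"
    using formulation_iff[OF assms(1) tt e assms(3,4) M] robust_overlap_nonneg[OF assms(1) e, of tt]
    by (auto simp: robust_hypograph_eq[OF assms(1) e])
next
  fix M tt e \<sigma>
  assume M: "horizon R + granularity R \<le> M" and tt: "tt \<in> timetables R"
    and e: "e \<in> right_pairs R sel" and "\<sigma> \<in> robust_hypograph R tt e"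
  then show "\<exists>l. formulation R M \<epsilon> tt e \<sigma> l \<and> (l = 1 \<longleftrightarrow> \<sigma> > 0)"
    unfolding formulation_iff[OF assms(1) tt e assms(3,4) M]
    by (intro exI[of _ "if \<sigma> > 0 then 1 else 0"]) (auto simp: robust_hypograph_eq[OF assms(1) e])
next
  fix M L tt \<sigma> l
  assume M: "horizon R + granularity R \<le> M"
  note F = formulation_iff[OF assms(1) _ _ assms(3,4) M]
  note nonneg = robust_overlap_nonneg[OF assms(1)]
  have "formulation_optimal R sel L M \<epsilon> tt \<sigma> l \<longleftrightarrow> robust_optimal R sel L tt \<sigma> \<and>
      (\<forall>e \<in> right_pairs R sel. formulation R M \<epsilon> tt e (robust_overlap R tt e) (l e))"
    unfolding formulation_optimal_def robust_optimal_def
  proof (rule hypograph_optimum_iff[OF finite_right_left_pairs[OF assms(1)]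
        right_left_pairs_disjoint])
    fix tt e s l
    assume e: "tt \<in> timetables R" "e \<in> right_pairs R sel" and "formulation R M \<epsilon> tt e s l"
    then show "s \<le> robust_overlap R tt e"
      using F[OF e] nonneg[OF e(2), of tt] by auto
  next
    fix tt e
    assume e: "tt \<in> timetables R" "e \<in> right_pairs R sel"
    then show "\<exists>l. formulation R M \<epsilon> tt e (robust_overlap R tt e) l"
      using nonneg[OF e(2), of tt]
      by (intro exI[of _ "if robust_overlap R tt e > 0 then 1 else 0"]) (auto simp: F)
  qed
  also have "\<dots> \<longleftrightarrow> robust_optimal R sel L tt \<sigma> \<and>
      (\<forall>e \<in> right_pairs R sel. l e \<in> {0, 1} \<and> (l e = 1 \<longleftrightarrow> \<sigma> e > 0))"
  proof (rule conj_cong[OF refl], rule ball_cong[OF refl])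
    fix e
    assume opt: "robust_optimal R sel L tt \<sigma>" and e: "e \<in> right_pairs R sel"
    then have tt: "tt \<in> timetables R" and \<sigma>: "\<sigma> e = robust_overlap R tt e"
      by (auto simp: robust_optimal_def is_arg_max_def)
    show "formulation R M \<epsilon> tt e (robust_overlap R tt e) (l e) \<longleftrightarrow>
        l e \<in> {0, 1} \<and> (l e = 1 \<longleftrightarrow> \<sigma> e > 0)"
      using nonneg[OF e, of tt] by (auto simp: F[OF tt e] \<sigma>)
  qed
  finally show "formulation_optimal R sel L M \<epsilon> tt \<sigma> l \<longleftrightarrow> robust_optimal R sel L tt \<sigma> \<and>
      (\<forall>e \<in> right_pairs R sel. l e \<in> {0, 1} \<and> (l e = 1 \<longleftrightarrow> \<sigma> e > 0))" .
qed

end
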